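(* Let $d\geq 1$ and let $G=(V,E)$ be a graph with $n$ vertices, where $n\geq d+1$. Then $$a(G,\ell_\infty^d)\leq \frac{n}{n-1}\left\lfloor \frac{1}{d}\min_{v\in V}\deg_G(v)\right\rfloor.$$
   Context: All graphs are finite and simple. $\ell_\infty^d=(\mathbb{R}^d,\|\cdot\|_\infty)$, $\|x\|_\infty=\max_i|x_i|$; $b_1,\ldots,b_d$ is the standard basis. A framework in $\ell_\infty^d$ is $(G,p)$, $p\in(\mathbb{R}^d)^V$, such that for every edge $vw$, $p_v\neq p_w$ and there is a unique index $i$ with $|(p_v-p_w)_i|=\|p_v-p_w\|_\infty$; $\mathcal{W}(G,\ell_\infty^d)$ denotes the set of such $p$, and for such an edge $\varphi_{v,w}=\operatorname{sgn}((p_v-p_w)_i)\,b_i^\top$. The rigidity matrix $R(G,p)$ is the $|E|\times d|V|$ matrix whose row for edge $vw$ has $\varphi_{v,w}$ in the columns of $v$, $-\varphi_{v,w}$ in the columns of $w$, zeros elsewhere; $L(G,p)=R(G,p)^\top R(G,p)$ with eigenvalues $\lambda_1\le\lambda_2\le\cdots$ counted with multiplicity. For $G$ with at least $d+1$ vertices, $a(G,\ell_\infty^d)=\sup\{\lambda_{d+1}(L(G,p)):p\in\mathcal{W}(G,\ell_\infty^d)\}$. *)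

theory Defs
  imports
    Complex_Main
    "HOL-Library.FuncSet"
    "Jordan_Normal_Form.Char_Poly"
begin

definition simple_graph :: "'v set \<Rightarrow> 'v set set \<Rightarrow> bool" where
  "simple_graph V E \<longleftrightarrow> finite V \<and> (\<forall>e\<in>E. e \<subseteq> V \<and> card e = 2)"

definition deg :: "'v set set \<Rightarrow> 'v \<Rightarrow> nat" where
  "deg E v = card {e \<in> E. v \<in> e}"

definition linf_norm :: "real vec \<Rightarrow> real" where
  "linf_norm x = Max ((\<lambda>i. \<bar>x $ i\<bar>) ` {..<dim_vec x})"

text \<open>The set \<open>\<W>(G, \<ell>\<^sub>\<infinity>\<^sup>d)\<close>; the coordinates of \<open>\<real>\<^sup>d\<close> are numbered \<open>0, \<dots>, d - 1\<close>.\<close>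

definition placements :: "nat \<Rightarrow> 'v set \<Rightarrow> 'v set set \<Rightarrow> ('v \<Rightarrow> real vec) set" where
  "placements d V E = {p \<in> V \<rightarrow>\<^sub>E carrier_vec d.
     \<forall>v w. {v, w} \<in> E \<longrightarrow>
       p v \<noteq> p w \<and>
       (\<exists>!i. i < d \<and> \<bar>(p v - p w) $ i\<bar> = linf_norm (p v - p w))}"

text \<open>\<open>\<phi>\<^bsub>v,w\<^esub>\<close> as a function of \<open>x = p\<^sub>v - p\<^sub>w\<close>.\<close>

definition support_functional :: "nat \<Rightarrow> real vec \<Rightarrow> real vec" where
  "support_functional d x =
     (let i = (THE i. i < d \<and> \<bar>x $ i\<bar> = linf_norm x)
      in sgn (x $ i) \<cdot>\<^sub>v unit_vec d i)"

text \<open>Rows and columns of the rigidity matrix are labelled by edges and by pairs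
  (vertex, coordinate). To obtain a matrix with numerical indices we fix some enumeration of
  the vertices and of the edges. Changing it permutes the rows of \<open>R\<close> and the column blocks,
  which leaves the spectrum of \<open>R\<^sup>T R\<close> unchanged.\<close>

definition enum_list :: "'a set \<Rightarrow> 'a list" where
  "enum_list A = (SOME xs. distinct xs \<and> set xs = A)"

lemma enum_list:
  assumes "finite A"
  shows "distinct (enum_list A)" and "set (enum_list A) = A"
proof -
  have "\<exists>xs. distinct xs \<and> set xs = A"
    using finite_distinct_list[OF assms] by blast
  then have "distinct (enum_list A) \<and> set (enum_list A) = A"
    unfolding enum_list_def by (rule someI_ex)
  then show "distinct (enum_list A)" and "set (enum_list A) = A" by auto
qed

text \<open>The order of the two endpoints is immaterial for the row of an edge, since
  \<open>\<phi>\<^bsub>w,v\<^esub> = - \<phi>\<^bsub>v,w\<^esub>\<close>.\<close>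

definition endpoints :: "'v set \<Rightarrow> 'v \<times> 'v" where
  "endpoints e = (SOME (v, w). e = {v, w})"

text \<open>Column \<open>c\<close> belongs to the vertex number \<open>c div d\<close> and the coordinate \<open>c mod d\<close>.\<close>

definition rigidity_matrix ::
    "nat \<Rightarrow> 'v set \<Rightarrow> 'v set set \<Rightarrow> ('v \<Rightarrow> real vec) \<Rightarrow> real mat" where
  "rigidity_matrix d V E p = mat (card E) (d * card V) (\<lambda>(r, c).
     let (v, w) = endpoints (enum_list E ! r);
         u = enum_list V ! (c div d);
         k = c mod d;
         \<phi> = support_functional d (p v - p w)
     in if u = v then \<phi> $ k else if u = w then - (\<phi> $ k) else 0)"

definition stiffness_matrix ::
    "nat \<Rightarrow> 'v set \<Rightarrow> 'v set set \<Rightarrow> ('v \<Rightarrow> real vec) \<Rightarrow> real mat" where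
  "stiffness_matrix d V E p =
     transpose_mat (rigidity_matrix d V E p) * rigidity_matrix d V E p"

text \<open>The \<open>k\<close>-th smallest eigenvalue (\<open>k \<ge> 1\<close>), counted with multiplicity as a root of the
  characteristic polynomial. Only meant for matrices whose eigenvalues are all real, such as
  symmetric ones.\<close>

definition nth_eigenvalue :: "nat \<Rightarrow> real mat \<Rightarrow> real" where
  "nth_eigenvalue k A = sorted_list_of_multiset (proots (char_poly A)) ! (k - 1)"

text \<open>\<open>a(G, \<ell>\<^sub>\<infinity>\<^sup>d)\<close>\<close>

definition alg_connectivity :: "nat \<Rightarrow> 'v set \<Rightarrow> 'v set set \<Rightarrow> real" where
  "alg_connectivity d V E =
     Sup {nth_eigenvalue (d + 1) (stiffness_matrix d V E p) | p. p \<in> placements d V E}"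

end

theory Submission
  imports Defs
begin

text \<open>
  Every row of the rigidity matrix acts in a single coordinate, so the stiffness matrix is the
  direct sum of the Laplacians of \<open>d\<close> edge-disjoint subgraphs of \<open>G\<close>. At a vertex \<open>v\<close> of minimum
  degree one of them, say the \<open>j\<close>-th, has degree at most \<open>\<lfloor>deg v / d\<rfloor>\<close>. The \<open>d\<close> translations
  together with the displacement of \<open>v\<close> in direction \<open>j\<close> span a space of dimension \<open>d + 1\<close> on
  which the Rayleigh quotient is at most \<open>n / (n - 1)\<close> times that degree (Fiedler's bound), and
  the Courant-Fischer principle bounds \<open>\<lambda>\<^bsub>d+1\<^esub>\<close>.
\<close>

section \<open>Spectral theorem for real symmetric matrices\<close>

text \<open>Real entries make the conjugate of an eigenvector for \<open>a\<close> an eigenvector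
  for \<open>cnj a\<close>. Symmetry moves \<open>A\<close> across the bilinear product of these two
  vectors; this product is the squared norm, hence nonzero, so \<open>cnj a = a\<close>.\<close>

lemma symmetric_complex_root_real:
  fixes A :: "real mat"
  assumes A: "A \<in> carrier_mat n n" and sym: "transpose_mat A = A"
    and root: "poly (char_poly (map_mat complex_of_real A)) a = 0"
  shows "Im a = 0"
proof -
  let ?A = "map_mat complex_of_real A"
  have cA: "?A \<in> carrier_mat n n" using A by simp
  from root obtain v where v: "v \<in> carrier_vec n" "v \<noteq> 0\<^sub>v n" and Av: "?A *\<^sub>v v = a \<cdot>\<^sub>v v"
    unfolding eigenvalue_root_char_poly[OF cA, symmetric] eigenvalue_def eigenvector_def
    using A by auto
  have cv: "conjugate v \<in> carrier_vec n" using v by simp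
  have Acv: "?A *\<^sub>v conjugate v = cnj a \<cdot>\<^sub>v conjugate v"
  proof -
    have "?A *\<^sub>v conjugate v = conjugate (?A *\<^sub>v v)"
      using A v by (intro eq_vecI) (auto simp: scalar_prod_def sum_conjugate conjugate_dist_mul)
    also have "\<dots> = cnj a \<cdot>\<^sub>v conjugate v"
      unfolding Av using v by (intro eq_vecI) (auto simp: conjugate_dist_mul)
    finally show ?thesis .
  qed
  have tA: "transpose_mat ?A = ?A"
    using arg_cong[OF sym, of "map_mat complex_of_real"] by (simp add: map_mat_transpose)
  have "(?A *\<^sub>v conjugate v) \<bullet> v = conjugate v \<bullet> (?A *\<^sub>v v)"
    using transpose_vec_mult_scalar[OF cA v(1) cv] tA by simp
  then have "cnj a * (conjugate v \<bullet> v) = a * (conjugate v \<bullet> v)"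
    unfolding Av Acv using v cv by simp
  moreover have "conjugate v \<bullet> v \<noteq> 0"
    using v conjugate_square_eq_0_vec[OF v(1)] comm_scalar_prod[OF v(1) cv] by auto
  ultimately have "cnj a = a" by simp
  then show ?thesis by (simp add: complex_eq_iff)
qed

text \<open>Over the complex numbers the polynomial splits, and all its roots are real.
  Coefficientwise embedding into the complex polynomials is injective, so the factorization descends
  to the reals.\<close>

lemma char_poly_symmetric_splits:
  fixes A :: "real mat"
  assumes A: "A \<in> carrier_mat n n" and sym: "transpose_mat A = A"
  shows "\<exists>es. char_poly A = (\<Prod>e\<leftarrow>es. [:- e, 1:]) \<and> length es = n"
proof -
  let ?A = "map_mat complex_of_real A"
  have cA: "?A \<in> carrier_mat n n" using A by simp
  from char_poly_factorized[OF cA] obtain as where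
    as: "char_poly ?A = (\<Prod>a\<leftarrow>as. [:- a, 1:])" and len: "length as = n" by blast
  have real: "complex_of_real (Re a) = a" if "a \<in> set as" for a
  proof -
    have "poly (char_poly ?A) a = 0"
      unfolding as poly_prod_list using that by (auto simp: prod_list_zero_iff)
    then show ?thesis
      using symmetric_complex_root_real[OF A sym] by (simp add: complex_eq_iff)
  qed
  interpret h: map_poly_inj_comm_ring_hom complex_of_real ..
  have "map_poly complex_of_real (char_poly A) = char_poly ?A"
    by (rule of_real_hom.char_poly_hom[OF A, symmetric])
  also have "\<dots> = (\<Prod>a\<leftarrow>as. map_poly complex_of_real [:- Re a, 1:])"
    unfolding as by (rule arg_cong[of _ _ prod_list], rule map_cong) (auto simp: real)
  also have "\<dots> = map_poly complex_of_real (\<Prod>e\<leftarrow>map Re as. [:- e, 1:])"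
    by (simp only: h.hom_prod_list map_map o_def)
  finally show ?thesis
    using len by (intro exI[of _ "map Re as"]) (simp only: h.injectivity length_map simp_thms)
qed

text \<open>The reflection that exchanges the first basis vector with \<open>v\<close> does this. It
  serves to extend a unit eigenvector to an orthonormal basis.\<close>

lemma Householder:
  fixes v :: "real vec"
  assumes v: "v \<in> carrier_vec n" and unit: "v \<bullet> v = 1" and n: "0 < n"
  shows "\<exists>H\<in>carrier_mat n n. transpose_mat H * H = 1\<^sub>m n \<and> col H 0 = v"
proof (cases "v = unit_vec n 0")
  case True
  then show ?thesis using n by (intro bexI[of _ "1\<^sub>m n"]) auto
next
  case False
  \<comment> \<open>\<open>w\<close> is \<open>v\<close> minus the first basis vector, the normal of
    the reflecting hyperplane; it is nonzero because the case of equality has been split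
    off.\<close>
  define w where "w i = v $ i - (if i = 0 then 1 else 0)" for i
  have vv: "(\<Sum>i<n. v $ i * v $ i) = 1"
    using unit v by (simp add: scalar_prod_def lessThan_atLeast0)
  have ww: "(\<Sum>i<n. w i * w i) = 2 * (1 - v $ 0)"
  proof -
    have "(\<Sum>i<n. w i * w i)
      = (\<Sum>i<n. v $ i * v $ i + (if i = 0 then 1 - 2 * v $ 0 else 0))"
      by (intro sum.cong) (auto simp: w_def algebra_simps)
    also have "\<dots> = 2 * (1 - v $ 0)"
      using n by (simp add: sum.distrib vv sum.delta)
    finally show ?thesis .
  qed
  have ne: "v $ 0 \<noteq> 1"
  proof
    assume "v $ 0 = 1"
    with ww have "(\<Sum>i<n. w i * w i) = 0" by simp
    then have "w i = 0" if "i < n" for i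
      using that by (subst (asm) sum_nonneg_eq_0_iff) auto
    then have "v = unit_vec n 0"
      using v by (intro eq_vecI) (force simp: w_def unit_vec_def)+
    with False show False by simp
  qed
  \<comment> \<open>By \<open>ww\<close> this is 2 divided by the squared norm of \<open>w\<close>,
    the usual coefficient of a reflection.\<close>
  define a where "a = 1 / (1 - v $ 0)"
  have a: "a * (1 - v $ 0) = 1" using ne by (simp add: a_def)
  define H where "H = mat n n (\<lambda>(i, j). (if i = j then 1 else 0) - a * w i * w j)"
  have H: "H \<in> carrier_mat n n" by (simp add: H_def)
  have "transpose_mat H * H = 1\<^sub>m n"
  proof (rule eq_matI)
    fix i j assume "i < dim_row (1\<^sub>m n :: real mat)" "j < dim_col (1\<^sub>m n :: real mat)"
    then have ij: "i < n" "j < n" by auto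
    have "(transpose_mat H * H) $$ (i, j) = (\<Sum>k<n. H $$ (k, i) * H $$ (k, j))"
      using H ij by (simp add: scalar_prod_def lessThan_atLeast0)
    also have "\<dots> = (\<Sum>k<n. (if k = i then (if i = j then 1 else 0) else 0)
       - (if k = i then a * w i * w j else 0) - (if k = j then a * w i * w j else 0)
       + a * a * w i * w j * (w k * w k))"
      using ij by (intro sum.cong) (auto simp: H_def algebra_simps)
    also have "\<dots> = (if i = j then 1 else 0) - 2 * (a * w i * w j)
        + a * a * w i * w j * (2 * (1 - v $ 0))"
      using ij unfolding ww[symmetric]
      by (simp add: sum.distrib sum_subtractf sum_distrib_left)
    also have "a * a * w i * w j * (2 * (1 - v $ 0)) = 2 * (a * w i * w j)"
      using arg_cong[OF a, of "\<lambda>r. 2 * (a * w i * w j) * r"] by (simp add: algebra_simps)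
    also have "(if i = j then 1 else 0) - 2 * (a * w i * w j) + 2 * (a * w i * w j)
      = 1\<^sub>m n $$ (i, j)"
      using ij by simp
    finally show "(transpose_mat H * H) $$ (i, j) = 1\<^sub>m n $$ (i, j)" .
  qed (use H in auto)
  moreover have "col H 0 = v"
  proof (rule eq_vecI)
    fix i assume "i < dim_vec v"
    then show "col H 0 $ i = v $ i"
      using v n arg_cong[OF a, of "\<lambda>r. r * w i"] by (auto simp: H_def w_def algebra_simps)
  qed (use H v in auto)
  ultimately show ?thesis using H by blast
qed

text \<open>Deflation, by induction on the list of roots: an orthogonal change of basis splits off
  one eigenvector, and the remaining block is again symmetric. The order of \<open>es\<close> is
  arbitrary and is kept on the diagonal, so a sorted list may be supplied later.\<close>

lemma real_spectral_theorem:
  fixes A :: "real mat"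
  assumes "A \<in> carrier_mat n n" and "transpose_mat A = A"
    and "char_poly A = (\<Prod>e\<leftarrow>es. [:- e, 1:])"
  shows "\<exists>U\<in>carrier_mat n n. transpose_mat U * U = 1\<^sub>m n \<and>
    transpose_mat U * A * U = mat n n (\<lambda>(i, j). if i = j then es ! i else 0)"
  using assms
proof (induction es arbitrary: n A)
  case Nil
  then have "n = 0" using degree_monic_char_poly[of A n] by simp
  then show ?case by (intro bexI[of _ "1\<^sub>m 0"]) auto
next
  case (Cons e es)
  note A = Cons.prems(1) and sym = Cons.prems(2)
  have root: "poly (char_poly A) e = 0" unfolding Cons.prems(3) by simp
  then obtain u where u: "u \<in> carrier_vec n" "u \<noteq> 0\<^sub>v n" and Au: "A *\<^sub>v u = e \<cdot>\<^sub>v u"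
    unfolding eigenvalue_root_char_poly[OF A, symmetric] eigenvalue_def eigenvector_def
    using A by auto
  have n: "0 < n"
  proof (rule ccontr)
    assume "\<not> 0 < n"
    with u show False by (auto simp: vec_eq_iff)
  qed
  then obtain m where m: "n = 1 + m" by (metis Suc_pred plus_1_eq_Suc)
  have uu: "u \<bullet> u > 0"
    using conjugate_square_greater_0_vec[OF u(1)] u(2) by (simp add: conjugate_vec_def)
  define v where "v = (1 / sqrt (u \<bullet> u)) \<cdot>\<^sub>v u"
  have v: "v \<in> carrier_vec n" using u by (simp add: v_def)
  have vv: "v \<bullet> v = 1"
    using u uu by (simp add: v_def field_simps)
  have Av: "A *\<^sub>v v = e \<cdot>\<^sub>v v"
    using A u Au by (simp add: v_def mult_mat_vec smult_smult_assoc mult.commute)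
  from Householder[OF v vv n] obtain H where H: "H \<in> carrier_mat n n"
    and HH: "transpose_mat H * H = 1\<^sub>m n" and H0: "col H 0 = v" by blast
  have HH': "H * transpose_mat H = 1\<^sub>m n"
    using mat_mult_left_right_inverse[OF _ H HH] H by simp
  let ?A' = "transpose_mat H * A * H"
  have A': "?A' \<in> carrier_mat n n" using A H by simp
  have sym': "transpose_mat ?A' = ?A'"
    using A H sym by (simp add: transpose_mult[of _ n n _ n] assoc_mult_mat[of _ n n _ n _ n])
  \<comment> \<open>The first column of \<open>H\<close> is the eigenvector \<open>v\<close>, so the
    first column of the conjugated matrix is \<open>e\<close> times the first column of the
    identity.\<close>
  have col0: "?A' $$ (i, 0) = (if i = 0 then e else 0)" if i: "i < n" for i
  proof -
    have "col ?A' 0 = transpose_mat H *\<^sub>v (A *\<^sub>v v)"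
    proof -
      have tH: "transpose_mat H \<in> carrier_mat n n" and AH: "A * H \<in> carrier_mat n n"
        using A H by auto
      show ?thesis
        unfolding assoc_mult_mat[OF tH A H] col_mult2[OF tH AH n] col_mult2[OF A H n] H0 ..
    qed
    also have "\<dots> = e \<cdot>\<^sub>v (transpose_mat H *\<^sub>v col H 0)"
      unfolding Av H0 using H v by (simp add: mult_mat_vec[of _ n n])
    also have "transpose_mat H *\<^sub>v col H 0 = col (transpose_mat H * H) 0"
      by (rule col_mult2[symmetric]) (use H n in auto)
    finally have *: "col ?A' 0 = e \<cdot>\<^sub>v col (1\<^sub>m n) 0" unfolding HH .
    have "?A' $$ (i, 0) = col ?A' 0 $ i" using A' H n i by simp
    then show ?thesis unfolding * using i n by simp
  qed
  define B where "B = mat m m (\<lambda>(i, j). ?A' $$ (Suc i, Suc j))"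
  have B: "B \<in> carrier_mat m m" by (simp add: B_def)
  let ?e = "mat 1 1 (\<lambda>_. e)"
  have symij: "?A' $$ (i, j) = ?A' $$ (j, i)" if "i < n" "j < n" for i j
    using sym' A' that by (metis carrier_matD index_transpose_mat(1))
  \<comment> \<open>Symmetry carries the zeros of the first column over to the first row.\<close>
  have A'_block: "?A' = four_block_mat ?e (0\<^sub>m 1 m) (0\<^sub>m m 1) B" (is "_ = ?R")
  proof (rule eq_matI)
    fix i j assume "i < dim_row ?R" "j < dim_col ?R"
    then have ij: "i < n" "j < n" using B m by auto
    show "?A' $$ (i, j) = ?R $$ (i, j)"
    proof (cases "j = 0")
      case True
      then show ?thesis using col0[OF ij(1)] ij m B by auto
    next
      case j: False
      show ?thesis
      proof (cases "i = 0")
        case True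
        then show ?thesis using col0[OF ij(2)] symij[OF ij] j ij m B by auto
      next
        case False
        then show ?thesis using j ij m by (auto simp: B_def)
      qed
    qed
  qed (use A' B H m in auto)
  have symB: "transpose_mat B = B"
  proof (rule eq_matI)
    fix i j assume "i < dim_row B" "j < dim_col B"
    then show "transpose_mat B $$ (i, j) = B $$ (i, j)"
      using symij[of "Suc i" "Suc j"] m by (simp add: B_def del: index_mult_mat)
  qed (simp_all add: B_def)
  \<comment> \<open>The transpose of \<open>H\<close> is its inverse, so the characteristic
    polynomial is unchanged; cancelling the factor of \<open>e\<close> leaves exactly the roots
    \<open>es\<close> for \<open>B\<close>.\<close>
  have "similar_mat A ?A'"
  proof -
    have "H * ?A' * transpose_mat H = (H * transpose_mat H) * A * (H * transpose_mat H)"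
      using A H by (simp add: assoc_mult_mat[of _ n n _ n _ n])
    also have "\<dots> = A" unfolding HH' using A by simp
    finally have "A = H * ?A' * transpose_mat H" ..
    then have "similar_mat_wit A ?A' H (transpose_mat H)"
      by (intro similar_mat_witI[of _ _ n] HH HH' A A' H) (use H in auto)
    then show ?thesis unfolding similar_mat_def by blast
  qed
  then have "char_poly A = char_poly ?A'" by (rule char_poly_similar)
  also have "\<dots> = char_poly ?e * char_poly B"
    unfolding A'_block by (rule char_poly_four_block_zeros_col) (use B in auto)
  finally have "char_poly A = char_poly ?e * char_poly B" .
  moreover have "char_poly ?e = [:- e, 1:]"
    by (simp add: char_poly_defs det_single)
  ultimately have "[:- e, 1:] * char_poly B = [:- e, 1:] * (\<Prod>e\<leftarrow>es. [:- e, 1:])"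
    using Cons.prems(3) by simp
  then have "char_poly B = (\<Prod>e\<leftarrow>es. [:- e, 1:])"
    by (subst (asm) mult_cancel_left) simp
  from Cons.IH[OF B symB this] obtain U where U: "U \<in> carrier_mat m m"
    and UU: "transpose_mat U * U = 1\<^sub>m m"
    and UBU: "transpose_mat U * B * U = mat m m (\<lambda>(i, j). if i = j then es ! i else 0)"
    by blast
  \<comment> \<open>\<open>U1\<close> fixes the split-off direction and diagonalizes the block
    \<open>B\<close>; the required basis is \<open>H * U1\<close>.\<close>
  define U1 where "U1 = four_block_mat (1\<^sub>m 1) (0\<^sub>m 1 m) (0\<^sub>m m 1) U"
  have U1: "U1 \<in> carrier_mat n n" unfolding m U1_def by (rule four_block_carrier_mat) (use U in auto)
  have tU: "transpose_mat U1 = four_block_mat (1\<^sub>m 1) (0\<^sub>m 1 m) (0\<^sub>m m 1) (transpose_mat U)"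
    unfolding U1_def using U by (subst transpose_four_block_mat[of _ 1 1 _ m _ m]) auto
  have "transpose_mat U1 * U1 = 1\<^sub>m n"
    unfolding tU unfolding U1_def using U UU m
    by (subst mult_four_block_mat[of _ 1 1 _ m _ m _ _ 1 _ m]) auto
  then have "transpose_mat (H * U1) * (H * U1) = 1\<^sub>m n"
  proof -
    have "transpose_mat (H * U1) * (H * U1) = transpose_mat U1 * (transpose_mat H * H) * U1"
      using U1 H by (simp add: transpose_mult[of _ n n _ n] assoc_mult_mat[of _ n n _ n _ n])
    then show ?thesis unfolding HH using U1 \<open>transpose_mat U1 * U1 = 1\<^sub>m n\<close> by simp
  qed
  moreover have "transpose_mat (H * U1) * A * (H * U1)
    = mat n n (\<lambda>(i, j). if i = j then (e # es) ! i else 0)"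
  proof -
    have "transpose_mat (H * U1) * A * (H * U1) = transpose_mat U1 * ?A' * U1"
      using U1 H A by (simp add: transpose_mult[of _ n n _ n] assoc_mult_mat[of _ n n _ n _ n])
    also have "\<dots> = four_block_mat ?e (0\<^sub>m 1 m) (0\<^sub>m m 1) (transpose_mat U * B * U)"
      unfolding tU A'_block unfolding U1_def using U B
      by (simp add: mult_four_block_mat[of _ 1 1 _ m _ m _ _ 1 _ m])
    also have "\<dots> = mat n n (\<lambda>(i, j). if i = j then (e # es) ! i else 0)"
      unfolding UBU using m by (intro eq_matI) (auto simp: nth_Cons')
    finally show ?thesis .
  qed
  ultimately show ?case using U1 H by (intro bexI[of _ "H * U1"]) auto
qed

section \<open>Upper bound of Courant-Fischer type\<close>

text \<open>The image of \<open>W\<close> has dimension \<open>k + 1\<close>, so it contains a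
  nonzero vector orthogonal to the eigenvectors of the \<open>k\<close> smallest eigenvalues. There
  the quadratic form is at least the next eigenvalue times the squared norm.\<close>

lemma nth_eigenvalue_le_Rayleigh:
  fixes A W :: "real mat"
  assumes A: "A \<in> carrier_mat n n" and sym: "transpose_mat A = A"
    and W: "W \<in> carrier_mat n (k + 1)" and k: "k < n"
    and inj: "\<And>y. y \<in> carrier_vec (k + 1) \<Longrightarrow> y \<noteq> 0\<^sub>v (k + 1) \<Longrightarrow> W *\<^sub>v y \<noteq> 0\<^sub>v n"
    and quot: "\<And>y. y \<in> carrier_vec (k + 1) \<Longrightarrow>
      (W *\<^sub>v y) \<bullet> (A *\<^sub>v (W *\<^sub>v y)) \<le> c * ((W *\<^sub>v y) \<bullet> (W *\<^sub>v y))"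
  shows "nth_eigenvalue (k + 1) A \<le> c"
proof -
  define es where "es = sorted_list_of_multiset (proots (char_poly A))"
  from char_poly_symmetric_splits[OF A sym] obtain as where
    as: "char_poly A = (\<Prod>e\<leftarrow>as. [:- e, 1:])" and len_as: "length as = n" by blast
  have "proots (\<Prod>e\<leftarrow>as. [:- e, 1:]) = mset as"
  proof (induction as)
    case (Cons a as)
    have "(\<Prod>e\<leftarrow>as. [:- e, 1:]) \<noteq> 0" by (auto simp: prod_list_zero_iff)
    then show ?case using Cons by (simp add: proots_mult del: mult_pCons_left)
  qed simp
  then have mset_es: "mset es = mset as" by (simp add: es_def as)
  have sorted: "sorted es" by (simp add: es_def)
  have len: "length es = n" using mset_es len_as by (metis size_mset)
  \<comment> \<open>The sorted list is a rearrangement of \<open>as\<close>; diagonalizing with it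
    puts the eigenvalues in ascending order.\<close>
  have "char_poly A = (\<Prod>e\<leftarrow>es. [:- e, 1:])"
    unfolding as using mset_es by (metis mset_map prod_mset_prod_list)
  from real_spectral_theorem[OF A sym this] obtain U where U: "U \<in> carrier_mat n n"
    and UU: "transpose_mat U * U = 1\<^sub>m n"
    and UAU: "transpose_mat U * A * U = mat n n (\<lambda>(i, j). if i = j then es ! i else 0)"
    by blast
  have UU': "U * transpose_mat U = 1\<^sub>m n"
    using mat_mult_left_right_inverse[OF _ U UU] U by simp
  let ?K = "k + 1"
  \<comment> \<open>Orthogonality to the first \<open>k\<close> eigenvectors is \<open>k\<close>
    equations in \<open>k + 1\<close> unknowns. A zero row makes the system square, so that its
    vanishing determinant yields a nontrivial solution \<open>y\<close>.\<close>
  define M where "M = mat\<^sub>r ?K ?K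
    (\<lambda>i. if i = k then 0\<^sub>v ?K else row (transpose_mat U * W) i)"
  have M: "M \<in> carrier_mat ?K ?K" by (simp add: M_def)
  have rowM: "row (transpose_mat U * W) i \<in> carrier_vec ?K" for i
    using W by (intro carrier_vecI) simp
  have "det M = 0" unfolding M_def by (rule det_row_0) (use rowM in auto)
  then obtain y where y: "y \<in> carrier_vec ?K" "y \<noteq> 0\<^sub>v ?K" and My: "M *\<^sub>v y = 0\<^sub>v ?K"
    using det_0_iff_vec_prod_zero_field[OF M] by blast
  define x where "x = W *\<^sub>v y"
  \<comment> \<open>The coordinates of the trial vector in the eigenbasis.\<close>
  define z where "z = transpose_mat U *\<^sub>v x"
  have x: "x \<in> carrier_vec n" using W y by (simp add: x_def)
  have z: "z \<in> carrier_vec n" using U x by (simp add: z_def)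
  have z0: "z $ i = 0" if "i < k" for i
  proof -
    have "z = (transpose_mat U * W) *\<^sub>v y"
      using U W y by (simp add: z_def x_def assoc_mult_mat_vec[of _ n n _ ?K])
    then have "z $ i = (M *\<^sub>v y) $ i"
      using that k U W by (simp add: M_def)
    then show ?thesis using that by (simp add: My)
  qed
  have xU: "x = U *\<^sub>v z"
    unfolding z_def using U x UU' by (simp flip: assoc_mult_mat_vec[of _ n n _ n])
  have "(U *\<^sub>v z) \<bullet> (U *\<^sub>v z) = (transpose_mat U *\<^sub>v (U *\<^sub>v z)) \<bullet> z"
    using transpose_vec_mult_scalar[OF U z, of "U *\<^sub>v z"] U z by simp
  also have "transpose_mat U *\<^sub>v (U *\<^sub>v z) = z"
    using U z UU by (simp flip: assoc_mult_mat_vec[of _ n n _ n])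
  finally have xx: "x \<bullet> x = (\<Sum>i<n. z $ i * z $ i)"
    unfolding xU using z by (simp add: scalar_prod_def lessThan_atLeast0)
  have "x \<bullet> (A *\<^sub>v x) = (A *\<^sub>v x) \<bullet> (U *\<^sub>v z)"
    using A x xU comm_scalar_prod[of x n "A *\<^sub>v x"] by simp
  also have "\<dots> = (transpose_mat U *\<^sub>v (A *\<^sub>v x)) \<bullet> z"
    using transpose_vec_mult_scalar[OF U z, of "A *\<^sub>v x"] A x by simp
  also have "transpose_mat U *\<^sub>v (A *\<^sub>v x) = (transpose_mat U * A * U) *\<^sub>v z"
    unfolding xU using U A z by (simp add: assoc_mult_mat_vec[of _ n n _ n])
  also have "\<dots> = vec n (\<lambda>i. es ! i * z $ i)"
    unfolding UAU
  proof (rule eq_vecI)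
    fix i assume "i < dim_vec (vec n (\<lambda>i. es ! i * z $ i))"
    then have i: "i < n" by simp
    then have "(mat n n (\<lambda>(i, j). if i = j then es ! i else 0) *\<^sub>v z) $ i
      = (\<Sum>j<n. (if i = j then es ! i else 0) * z $ j)"
      using z by (simp add: scalar_prod_def lessThan_atLeast0)
    also have "\<dots> = (\<Sum>j<n. if j = i then es ! i * z $ i else 0)"
      by (intro sum.cong) auto
    finally show "(mat n n (\<lambda>(i, j). if i = j then es ! i else 0) *\<^sub>v z) $ i
      = vec n (\<lambda>i. es ! i * z $ i) $ i"
      using i by (simp add: sum.delta)
  qed simp
  finally have xAx: "x \<bullet> (A *\<^sub>v x) = (\<Sum>i<n. es ! i * (z $ i * z $ i))"
    using z by (simp add: scalar_prod_def lessThan_atLeast0 mult.assoc)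
  \<comment> \<open>Terms with \<open>i < k\<close> vanish by \<open>z0\<close>; in the others
    \<open>es ! k \<le> es ! i\<close>. Since lists count from 0, \<open>es ! k\<close> is the
    eigenvalue number \<open>k + 1\<close>.\<close>
  have "es ! k * (x \<bullet> x) \<le> x \<bullet> (A *\<^sub>v x)"
    unfolding xx xAx sum_distrib_left
  proof (rule sum_mono)
    fix i assume "i \<in> {..<n}"
    then show "es ! k * (z $ i * z $ i) \<le> es ! i * (z $ i * z $ i)"
      using sorted_nth_mono[OF sorted, of k i] z0[of i] len
      by (cases "i < k") (auto intro: mult_right_mono)
  qed
  also have "\<dots> \<le> c * (x \<bullet> x)" using quot[OF y(1)] by (simp add: x_def)
  finally have "es ! k * (x \<bullet> x) \<le> c * (x \<bullet> x)" .
  moreover have "x \<bullet> x > 0"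
    using conjugate_square_greater_0_vec[OF x] inj[OF y] by (simp add: conjugate_vec_def x_def)
  ultimately show ?thesis by (simp add: nth_eigenvalue_def es_def)
qed

section \<open>Sums over enumerated vertices, edges and columns\<close>

lemma sum_nth_enum_list:
  assumes "finite A"
  shows "(\<Sum>i<card A. f (enum_list A ! i)) = sum f A"
proof -
  have "bij_betw (\<lambda>i. enum_list A ! i) {..<card A} A"
    using enum_list[OF assms] by (intro bij_betw_nth) (metis distinct_card)+
  then show ?thesis by (rule sum.reindex_bij_betw)
qed

lemma sum_div_mod:
  fixes f :: "nat \<Rightarrow> nat \<Rightarrow> 'a :: comm_monoid_add"
  assumes "0 < d"
  shows "(\<Sum>c<d * n. f (c div d) (c mod d)) = (\<Sum>a<n. \<Sum>k<d. f a k)"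
proof -
  have "a * d + k < d * n" if "a < n" "k < d" for a k
  proof -
    have "a * d + k < (a + 1) * d" using that by simp
    also have "\<dots> \<le> n * d" using that by (intro mult_right_mono) auto
    finally show ?thesis by (simp add: mult.commute)
  qed
  then show ?thesis
    unfolding sum.cartesian_product
    by (intro sum.reindex_bij_witness[of _ "\<lambda>(a, k). a * d + k" "\<lambda>c. (c div d, c mod d)"])
       (use assms in \<open>auto simp: less_mult_imp_div_less mult.commute\<close>)
qed

text \<open>This removes the numerical indexing: from here on, products with the rigidity matrix
  become sums over vertices and coordinates.\<close>

lemma sum_columns:
  fixes f :: "'v \<Rightarrow> nat \<Rightarrow> 'a :: comm_monoid_add"
  assumes "finite V" and "0 < d"
  shows "(\<Sum>c<d * card V. f (enum_list V ! (c div d)) (c mod d)) = (\<Sum>u\<in>V. \<Sum>k<d. f u k)"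
  using sum_div_mod[OF assms(2), of "\<lambda>a. f (enum_list V ! a)" "card V"]
    sum_nth_enum_list[OF assms(1), of "\<lambda>u. \<Sum>k<d. f u k"] by simp

section \<open>Energy and norm of a displacement\<close>

lemma endpoints_edge:
  assumes "card e = 2" and "endpoints e = (a, b)"
  shows "e = {a, b}" and "a \<noteq> b"
proof -
  from assms(1) obtain x y where xy: "e = {x, y}" by (auto simp: card_2_iff)
  have "case endpoints e of (v, w) \<Rightarrow> e = {v, w}"
    unfolding endpoints_def by (rule someI[of _ "(x, y)"]) (simp add: xy)
  then show "e = {a, b}" using assms(2) by simp
  then show "a \<noteq> b" using assms(1) by auto
qed

text \<open>The colour of an edge; the colour classes are the \<open>d\<close> edge-disjoint
  subgraphs. The index is the same \<open>THE\<close> term as in \<open>support_functional\<close>,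
  so the two agree whatever value it takes.\<close>

definition edge_coordinate :: "nat \<Rightarrow> ('v \<Rightarrow> real vec) \<Rightarrow> 'v set \<Rightarrow> nat" where
  "edge_coordinate d p e =
     (case endpoints e of (v, w) \<Rightarrow>
        THE i. i < d \<and> \<bar>(p v - p w) $ i\<bar> = linf_norm (p v - p w))"

text \<open>The functional is a sign times a unit vector. As \<open>sgn\<close> may be 0, this is an
  inequality, in the direction that an upper bound on the energy needs.\<close>

lemma support_functional_square_le:
  assumes "endpoints e = (a, b)" and "k < d"
  shows "(support_functional d (p a - p b) $ k)\<^sup>2 \<le> (if edge_coordinate d p e = k then 1 else 0)"
  using assms
  by (auto simp: support_functional_def edge_coordinate_def Let_def unit_vec_def sgn_if)

lemma rigidity_matrix_carrier:
  "rigidity_matrix d V E p \<in> carrier_mat (card E) (d * card V)"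
  by (simp add: rigidity_matrix_def)

text \<open>A translation plus a displacement of \<open>v\<close> by \<open>t\<close> in direction \<open>j\<close> is only resisted
  by the edges at \<open>v\<close> that act in direction \<open>j\<close>.\<close>

definition displacement ::
    "nat \<Rightarrow> 'v set \<Rightarrow> 'v \<Rightarrow> nat \<Rightarrow> (nat \<Rightarrow> real) \<Rightarrow> real \<Rightarrow> real vec" where
  "displacement d V v j \<alpha> t = vec (d * card V) (\<lambda>c.
     \<alpha> (c mod d) + (if enum_list V ! (c div d) = v \<and> c mod d = j then t else 0))"

text \<open>A row carries opposite entries at its two endpoints, so the translation cancels. What
  remains comes from \<open>v\<close>, with a sign telling which endpoint \<open>v\<close>
  is.\<close>

lemma rigidity_matrix_displacement:
  assumes fin: "finite V" and d: "0 < d" and j: "j < d" and r: "r < card E"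
    and e: "enum_list E ! r = e" "e \<subseteq> V" "card e = 2" "endpoints e = (a, b)"
  shows "(rigidity_matrix d V E p *\<^sub>v displacement d V v j \<alpha> t) $ r
    = support_functional d (p a - p b) $ j * (if a = v then t else if b = v then - t else 0)"
proof -
  note ab = endpoints_edge[OF e(3,4)]
  let ?\<phi> = "support_functional d (p a - p b)"
  let ?X = "\<lambda>u k. \<alpha> k + (if u = v \<and> k = j then t else 0)"
  have abV: "a \<in> V" "b \<in> V" using ab e(2) by auto
  have "(rigidity_matrix d V E p *\<^sub>v displacement d V v j \<alpha> t) $ r
    = (\<Sum>c<d * card V.
         (\<lambda>u k. (if u = a then ?\<phi> $ k else if u = b then - (?\<phi> $ k) else 0) * ?X u k)
         (enum_list V ! (c div d)) (c mod d))"
    using r e by (simp add: rigidity_matrix_def displacement_def scalar_prod_def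
        lessThan_atLeast0 Let_def)
  also have "\<dots> = (\<Sum>u\<in>V. \<Sum>k<d.
      (if u = a then ?\<phi> $ k else if u = b then - (?\<phi> $ k) else 0) * ?X u k)"
    by (rule sum_columns[OF fin d])
  \<comment> \<open>As \<open>a\<close> and \<open>b\<close> differ, the nested conditional is a
    difference of two separate ones.\<close>
  also have "\<dots> = (\<Sum>u\<in>V. (if u = a then \<Sum>k<d. ?\<phi> $ k * ?X a k else 0)
      - (if u = b then \<Sum>k<d. ?\<phi> $ k * ?X b k else 0))"
    using ab(2) by (intro sum.cong) (auto simp: sum_negf)
  also have "\<dots> = (\<Sum>k<d. ?\<phi> $ k * ?X a k) - (\<Sum>k<d. ?\<phi> $ k * ?X b k)"
    using abV fin by (simp add: sum_subtractf)
  also have "\<dots> = (\<Sum>k<d. if k = j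
      then ?\<phi> $ j * (if a = v then t else if b = v then - t else 0) else 0)"
    using ab(2) unfolding sum_subtractf[symmetric]
    by (intro sum.cong) (auto simp: algebra_simps)
  finally show ?thesis using j by simp
qed

text \<open>The quadratic form is the squared norm of the rigidity matrix applied to
  \<open>x\<close>, a sum of squares over edges. Each square is at most \<open>t\<^sup>2\<close>,
  and it vanishes unless the edge meets \<open>v\<close> and has colour \<open>j\<close>.\<close>

lemma stiffness_displacement_le:
  fixes v :: 'v and \<alpha> :: "nat \<Rightarrow> real" and t :: real
  assumes G: "simple_graph V E" and d: "0 < d" and j: "j < d"
  defines "x \<equiv> displacement d V v j \<alpha> t"
  shows "x \<bullet> (stiffness_matrix d V E p *\<^sub>v x)
    \<le> t\<^sup>2 * card {e \<in> E. v \<in> e \<and> edge_coordinate d p e = j}"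
proof -
  let ?R = "rigidity_matrix d V E p"
  have fin: "finite V" and E: "\<And>e. e \<in> E \<Longrightarrow> e \<subseteq> V \<and> card e = 2"
    using G by (auto simp: simple_graph_def)
  have finE: "finite E" using fin E by (intro finite_subset[of E "Pow V"]) auto
  have x: "x \<in> carrier_vec (d * card V)" by (simp add: x_def displacement_def)
  note R = rigidity_matrix_carrier[of d V E p]
  have Rx: "?R *\<^sub>v x \<in> carrier_vec (card E)" using R x by simp
  have "x \<bullet> (stiffness_matrix d V E p *\<^sub>v x) = x \<bullet> (transpose_mat ?R *\<^sub>v (?R *\<^sub>v x))"
    unfolding stiffness_matrix_def using R x
    by (subst assoc_mult_mat_vec[of _ "d * card V" "card E" _ "d * card V"]) auto
  also have "\<dots> = (?R *\<^sub>v x) \<bullet> (?R *\<^sub>v x)"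
    using transpose_vec_mult_scalar[OF R x Rx] R x Rx
      comm_scalar_prod[of x "d * card V" "transpose_mat ?R *\<^sub>v (?R *\<^sub>v x)"] by simp
  also have "\<dots> = (\<Sum>r<card E. ((?R *\<^sub>v x) $ r)\<^sup>2)"
    using R by (simp add: scalar_prod_def lessThan_atLeast0 power2_eq_square)
  also have "\<dots> \<le> (\<Sum>r<card E. (\<lambda>e. if v \<in> e \<and> edge_coordinate d p e = j then t\<^sup>2 else 0)
      (enum_list E ! r))"
  proof (rule sum_mono)
    fix r assume "r \<in> {..<card E}"
    then have r: "r < card E" by simp
    let ?e = "enum_list E ! r"
    have "?e \<in> E" using r enum_list[OF finE] by (metis distinct_card nth_mem)
    with E have e: "?e \<subseteq> V" "card ?e = 2" by auto
    obtain a b where ep: "endpoints ?e = (a, b)" by (cases "endpoints ?e")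
    note ab = endpoints_edge[OF e(2) ep]
    show "((?R *\<^sub>v x) $ r)\<^sup>2
      \<le> (\<lambda>e. if v \<in> e \<and> edge_coordinate d p e = j then t\<^sup>2 else 0) ?e"
      unfolding x_def rigidity_matrix_displacement[OF fin d j r refl e ep] power_mult_distrib
      using mult_right_mono[OF support_functional_square_le[OF ep j, of p], of "t\<^sup>2"] ab
      by (auto split: if_splits)
  qed
  also have "\<dots> = (\<Sum>e\<in>E. if v \<in> e \<and> edge_coordinate d p e = j then t\<^sup>2 else 0)"
    by (rule sum_nth_enum_list[OF finE])
  also have "\<dots> = t\<^sup>2 * card {e \<in> E. v \<in> e \<and> edge_coordinate d p e = j}"
    using finE by (simp add: sum.If_cases Int_def)
  finally show ?thesis .
qed

text \<open>In coordinate \<open>j\<close> the vector is a constant plus \<open>t\<close> at one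
  vertex. The best constant is \<open>-t/n\<close>, which leaves squared norm
  \<open>t\<^sup>2 * (n - 1) / n\<close>; this is the source of the factor
  \<open>n / (n - 1)\<close>.\<close>

lemma displacement_norm_ge:
  fixes v :: 'v and \<alpha> :: "nat \<Rightarrow> real" and t :: real
  assumes fin: "finite V" and v: "v \<in> V" and n: "1 < card V" and j: "j < d"
  defines "x \<equiv> displacement d V v j \<alpha> t"
  shows "t\<^sup>2 \<le> card V / (card V - 1) * (x \<bullet> x)"
proof -
  let ?n = "real (card V)"
  have d: "0 < d" using j by simp
  have n1: "?n > 1" using n by simp
  have "x \<bullet> x = (\<Sum>c<d * card V.
         (\<lambda>u k. (\<alpha> k + (if u = v \<and> k = j then t else 0))\<^sup>2) (enum_list V ! (c div d)) (c mod d))"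
    by (simp add: x_def displacement_def scalar_prod_def lessThan_atLeast0 power2_eq_square)
  also have "\<dots> = (\<Sum>u\<in>V. \<Sum>k<d. (\<alpha> k + (if u = v \<and> k = j then t else 0))\<^sup>2)"
    by (rule sum_columns[OF fin d])
  \<comment> \<open>Only coordinate \<open>j\<close> is kept; the others contribute nonnegative
    squares.\<close>
  also have "\<dots> \<ge> (\<Sum>u\<in>V. (\<alpha> j + (if u = v then t else 0))\<^sup>2)"
  proof (rule sum_mono)
    fix u
    show "(\<alpha> j + (if u = v then t else 0))\<^sup>2
      \<le> (\<Sum>k<d. (\<alpha> k + (if u = v \<and> k = j then t else 0))\<^sup>2)"
      using member_le_sum[of j "{..<d}" "\<lambda>k. (\<alpha> k + (if u = v \<and> k = j then t else 0))\<^sup>2"] j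
      by simp
  qed
  also have "(\<Sum>u\<in>V. (\<alpha> j + (if u = v then t else 0))\<^sup>2)
    = (\<Sum>u\<in>V. (\<alpha> j)\<^sup>2 + (if u = v then 2 * \<alpha> j * t + t\<^sup>2 else 0))"
    by (intro sum.cong) (auto simp: power2_sum)
  also have "\<dots> = ?n * (\<alpha> j)\<^sup>2 + 2 * \<alpha> j * t + t\<^sup>2"
    using fin v by (simp add: sum.distrib)
  finally have "?n * (\<alpha> j)\<^sup>2 + 2 * \<alpha> j * t + t\<^sup>2 \<le> x \<bullet> x" .
  then have "?n * (?n * (\<alpha> j)\<^sup>2 + 2 * \<alpha> j * t + t\<^sup>2) \<le> ?n * (x \<bullet> x)"
    by (intro mult_left_mono) auto
  \<comment> \<open>Completing the square in \<open>\<alpha> j\<close>, after multiplication by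
    \<open>n\<close> to avoid fractions.\<close>
  moreover have "?n * (?n * (\<alpha> j)\<^sup>2 + 2 * \<alpha> j * t + t\<^sup>2) = (?n * \<alpha> j + t)\<^sup>2 + (?n - 1) * t\<^sup>2"
    by (simp add: power2_eq_square algebra_simps)
  ultimately have "(?n - 1) * t\<^sup>2 \<le> ?n * (x \<bullet> x)"
    using zero_le_power2[of "?n * \<alpha> j + t"] by linarith
  then show ?thesis using n1 n by (simp add: field_simps of_nat_diff)
qed

section \<open>The sparse colour and the trial space\<close>

text \<open>Pigeonhole: otherwise \<open>d\<close> disjoint classes of more than
  \<open>card S div d\<close> elements each would exceed \<open>card S\<close>. The classes need not
  cover \<open>S\<close>. The integer division becomes the floor of the final bound.\<close>

lemma exists_sparse_colour:
  assumes "finite S" and "0 < d"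
  shows "\<exists>j<d. card {e \<in> S. f e = j} \<le> card S div d"
proof (rule ccontr)
  assume "\<not> ?thesis"
  then have *: "card S div d + 1 \<le> card {e \<in> S. f e = j}" if "j < d" for j
    using that by (metis Suc_eq_plus1 Suc_leI not_le)
  have "d * (card S div d + 1) = (\<Sum>j<d. card S div d + 1)" by simp
  also have "\<dots> \<le> (\<Sum>j<d. card {e \<in> S. f e = j})" using * by (intro sum_mono) auto
  also have "\<dots> = card (\<Union>j<d. {e \<in> S. f e = j})"
    using assms by (intro card_UN_disjoint[symmetric]) auto
  also have "\<dots> \<le> card S" using assms by (intro card_mono) auto
  also have "\<dots> < d * (card S div d + 1)"
    using assms(2) by (metis dividend_less_div_times mult.commute Suc_eq_plus1 mult_Suc add.commute)
  finally show False by simp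
qed

text \<open>The colour \<open>j\<close> depends on \<open>p\<close>, but the bound does not, so it
  passes to the supremum over placements.\<close>

lemma nth_eigenvalue_stiffness_le:
  assumes d: "0 < d" and G: "simple_graph V E" and n: "1 < card V" and v: "v \<in> V"
  shows "nth_eigenvalue (d + 1) (stiffness_matrix d V E p)
    \<le> card V / (card V - 1) * (deg E v div d)"
proof -
  let ?n = "card V"
  let ?L = "stiffness_matrix d V E p"
  let ?N = "d * ?n"
  have fin: "finite V" and E: "\<And>e. e \<in> E \<Longrightarrow> e \<subseteq> V"
    using G by (auto simp: simple_graph_def)
  have finE: "finite E" using fin E by (intro finite_subset[of E "Pow V"]) auto
  obtain j where j: "j < d"
    and Dj: "card {e \<in> {e \<in> E. v \<in> e}. edge_coordinate d p e = j} \<le> deg E v div d"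
    using exists_sparse_colour[of "{e \<in> E. v \<in> e}" d] finE d unfolding deg_def by auto
  note R = rigidity_matrix_carrier[of d V E p]
  have L: "?L \<in> carrier_mat ?N ?N" unfolding stiffness_matrix_def using R by simp
  have sym: "transpose_mat ?L = ?L"
    unfolding stiffness_matrix_def using R by (simp add: transpose_mult[of _ ?N "card E" _ ?N])
  \<comment> \<open>Columns \<open>0\<close> to \<open>d - 1\<close> are the translations; column
    \<open>d\<close> moves \<open>v\<close> alone by one unit in direction \<open>j\<close>.\<close>
  define W where "W = mat ?N (d + 1) (\<lambda>(c, l).
    if l < d then (if c mod d = l then 1 else 0)
    else if enum_list V ! (c div d) = v \<and> c mod d = j then 1 else (0 :: real))"
  have W: "W \<in> carrier_mat ?N (d + 1)" by (simp add: W_def)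
  have Wy: "W *\<^sub>v y = displacement d V v j (\<lambda>k. y $ k) (y $ d)"
    if y: "y \<in> carrier_vec (d + 1)" for y
  proof (rule eq_vecI)
    fix c assume "c < dim_vec (displacement d V v j (\<lambda>k. y $ k) (y $ d))"
    then have c: "c < ?N" by (simp add: displacement_def)
    have "(W *\<^sub>v y) $ c = (\<Sum>l<d + 1. W $$ (c, l) * y $ l)"
      using W y c by (simp add: scalar_prod_def lessThan_atLeast0)
    also have "\<dots> = (\<Sum>l<d. if l = c mod d then y $ l else 0) + W $$ (c, d) * y $ d"
    proof -
      have "(\<Sum>l<d. W $$ (c, l) * y $ l) = (\<Sum>l<d. if l = c mod d then y $ l else 0)"
        using c by (intro sum.cong) (auto simp: W_def)
      then show ?thesis by simp
    qed
    also have "\<dots> = y $ (c mod d) + W $$ (c, d) * y $ d" using d by simp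
    finally show "(W *\<^sub>v y) $ c = displacement d V v j (\<lambda>k. y $ k) (y $ d) $ c"
      using c by (simp add: displacement_def W_def)
  qed (simp add: W_def displacement_def)
  \<comment> \<open>This estimate serves twice: for the injectivity of \<open>W\<close> and for the
    Rayleigh quotient.\<close>
  have norm: "(y $ d)\<^sup>2 \<le> ?n / (?n - 1) * ((W *\<^sub>v y) \<bullet> (W *\<^sub>v y))"
    if "y \<in> carrier_vec (d + 1)" for y
    unfolding Wy[OF that] by (rule displacement_norm_ge[OF fin v n j])
  show ?thesis
  proof (rule nth_eigenvalue_le_Rayleigh[OF L sym W])
    show "d < ?N" using d n by simp
  next
    fix y :: "real vec" assume y: "y \<in> carrier_vec (d + 1)" "y \<noteq> 0\<^sub>v (d + 1)"
    show "W *\<^sub>v y \<noteq> 0\<^sub>v ?N"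
    proof
      assume 0: "W *\<^sub>v y = 0\<^sub>v ?N"
      have yd: "y $ d = 0" using norm[OF y(1)] unfolding 0 by simp
      have "y $ k = 0" if k: "k < d" for k
      proof -
        \<comment> \<open>Entry \<open>k < d\<close> belongs to the first enumerated vertex and
          coordinate \<open>k\<close>. Once \<open>y $ d = 0\<close>, it reads off the translation
          coefficient \<open>y $ k\<close>.\<close>
        have kN: "k < ?N" using k n by (metis less_le_trans mult_le_mono2 mult.right_neutral less_imp_le)
        have "(W *\<^sub>v y) $ k = y $ k"
          unfolding Wy[OF y(1)] using k kN yd by (simp add: displacement_def)
        then show ?thesis unfolding 0 using kN by simp
      qed
      with yd have "y = 0\<^sub>v (d + 1)" using y(1) by (intro eq_vecI) (auto simp: less_Suc_eq)
      with y(2) show False by simp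
    qed
  next
    fix y :: "real vec" assume y: "y \<in> carrier_vec (d + 1)"
    let ?x = "W *\<^sub>v y"
    have "?x \<bullet> (?L *\<^sub>v ?x)
      \<le> (y $ d)\<^sup>2 * card {e \<in> E. v \<in> e \<and> edge_coordinate d p e = j}"
      unfolding Wy[OF y] by (rule stiffness_displacement_le[OF G d j])
    also have "\<dots> \<le> (y $ d)\<^sup>2 * (deg E v div d)"
      using Dj by (intro mult_left_mono) (auto simp: conj_assoc)
    also have "\<dots> \<le> ?n / (?n - 1) * (?x \<bullet> ?x) * (deg E v div d)"
      by (intro mult_right_mono norm y) simp
    finally show "?x \<bullet> (?L *\<^sub>v ?x) \<le> ?n / (?n - 1) * (deg E v div d) * (?x \<bullet> ?x)"
      by (simp add: ac_simps)
  qed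
qed

section \<open>Existence of placements and the supremum\<close>

text \<open>Distinct integer points on the first axis work: every difference along an edge is a
  nonzero multiple of the first basis vector, so its maximal coordinate is unique. Nonemptiness
  matters because \<open>Sup\<close> of the empty set of reals has no useful value.\<close>

lemma placements_nonempty:
  fixes V :: "'v set"
  assumes d: "0 < d" and G: "simple_graph V E"
  shows "placements d V E \<noteq> {}"
proof -
  have fin: "finite V" and E: "\<And>e. e \<in> E \<Longrightarrow> e \<subseteq> V \<and> card e = 2"
    using G by (auto simp: simple_graph_def)
  obtain f :: "'v \<Rightarrow> nat" where f: "inj_on f V"
    using finite_imp_inj_to_nat_seg[OF fin] by blast
  define p where "p = (\<lambda>v\<in>V. real (f v) \<cdot>\<^sub>v unit_vec d 0)"
  have "p v \<noteq> p w \<and> (\<exists>!i. i < d \<and> \<bar>(p v - p w) $ i\<bar> = linf_norm (p v - p w))"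
    if vw: "{v, w} \<in> E" for v w
  proof -
    from E[OF vw] have V: "v \<in> V" "w \<in> V" and "v \<noteq> w" by auto
    then have ne: "f v \<noteq> f w" using f by (auto dest: inj_onD)
    let ?a = "\<bar>real (f v) - real (f w)\<bar>"
    have idx: "\<bar>(p v - p w) $ i\<bar> = (if i = 0 then ?a else 0)" if "i < d" for i
      using that V by (simp add: p_def)
    have dim: "dim_vec (p v - p w) = d" using V by (simp add: p_def)
    have "linf_norm (p v - p w) = Max ((\<lambda>i. if i = 0 then ?a else 0) ` {..<d})"
      unfolding linf_norm_def dim using idx by (intro arg_cong[of _ _ Max] image_cong) auto
    also have "\<dots> = ?a" using d by (intro Max_eqI) auto
    finally have norm: "linf_norm (p v - p w) = ?a" .
    have "\<exists>!i. i < d \<and> \<bar>(p v - p w) $ i\<bar> = linf_norm (p v - p w)"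
      unfolding norm using d ne idx by (intro ex1I[of _ 0]) (auto split: if_splits)
    moreover have "p v \<noteq> p w"
    proof
      assume "p v = p w"
      then have "\<bar>(p v - p w) $ 0\<bar> = 0" using d V by (simp add: p_def)
      then show False using idx[OF d] ne by simp
    qed
    ultimately show ?thesis by blast
  qed
  moreover have "p \<in> V \<rightarrow>\<^sub>E carrier_vec d" by (auto simp: p_def)
  ultimately have "p \<in> placements d V E" by (auto simp: placements_def)
  then show ?thesis by blast
qed

theorem theorem4p9:
  fixes V :: "'v set" and E :: "'v set set" and d n :: nat
  assumes "d \<ge> 1"
    and "simple_graph V E"
    and "card V = n"
    and "n \<ge> d + 1"
  shows "alg_connectivity d V E
    \<le> real n / (real n - 1) * of_int \<lfloor>real (Min (deg E ` V)) / real d\<rfloor>"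
proof -
  have d: "0 < d" and n: "1 < card V" using assms by auto
  have "finite V" using assms(2) by (simp add: simple_graph_def)
  moreover have "V \<noteq> {}" using n by auto
  ultimately have "Min (deg E ` V) \<in> deg E ` V" by (intro Min_in) auto
  then obtain v where v: "v \<in> V" and min: "Min (deg E ` V) = deg E v" by auto
  \<comment> \<open>The bound at a vertex of minimum degree, uniform in \<open>p\<close>; the floor
    of the real quotient is the integer division of naturals.\<close>
  have "nth_eigenvalue (d + 1) (stiffness_matrix d V E p)
    \<le> real n / (real n - 1) * of_int \<lfloor>real (Min (deg E ` V)) / real d\<rfloor>" for p
    using nth_eigenvalue_stiffness_le[OF d assms(2) n v, of p] n
    unfolding min assms(3)[symmetric] by (simp add: floor_divide_of_nat_eq of_nat_diff)
  then show ?thesis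
    unfolding alg_connectivity_def using placements_nonempty[OF d assms(2)]
    by (intro cSup_least) auto
qed

end
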